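(* Suppose that $\sum_{n=0}^\infty a_n^{-1}<\infty$, that $\beta_n\to\beta_\infty$ as $n\to\infty$ with $|\beta_\infty|<1$, that $\sum_n |k_n-1|<\infty$, and that $\sum_n|\beta_{n+1}-\beta_n|<\infty$. Then the Jacobi equation $$a_{n-1}F_{n-1}+b_nF_n+a_nF_{n+1}=zF_n,\qquad n\in\mathbb Z_+,$$ has a solution $(f_n(z))$ with asymptotics $$f_n(z)=\frac1{\sqrt{a_n}}\,e^{-i\phi_n}\big(1+O(\varepsilon_n)\big),\qquad n\to\infty .$$ This asymptotics is uniform in $z$ from compact subsets of $\mathbb C$. For all $n\in\mathbb Z_+$, the functions $f_n(z)$ are entire functions of $z\in\mathbb C$ of minimal exponential type.
   Context: $\mathbb Z_+=\{0,1,2,\dots\}$. The coefficients satisfy $a_n>0$, $b_n\in\mathbb R$ for $n\in\mathbb Z_+$, and by convention $a_{-1}=1/2$. Notation: $$\beta_n=-\frac{b_n}{2\sqrt{a_{n-1}a_n}},\qquad \alpha_n=\frac1{2\sqrt{a_{n-1}a_n}},\qquad k_n=\frac{a_n}{\sqrt{a_{n-1}a_{n+1}}}.$$ The phase is $\phi_n=\sum_{m}\arccos\beta_m$, the sum being over those $m\in\{0,\dots,n-1\}$ with $|\beta_m|\le1$ ($\arccos$ takes values in $[0,\pi]$). The remainder is $$\varepsilon_n=\sum_{m=n+1}^\infty\big(|\beta_{m-1}-\beta_m|+|k_m-1|+\alpha_m|z|\big).$$ An entire function $h$ is of minimal exponential type if for every $\varepsilon>0$ there is $C(\varepsilon)$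 with $|h(z)|\le C(\varepsilon)e^{\varepsilon|z|}$ for all $z\in\mathbb C$. *)

theory Defs
  imports "HOL-Complex_Analysis.Complex_Analysis" "HOL-Library.Landau_Symbols"
begin

text \<open>
  Coefficients are sequences \<open>a, b :: nat \<Rightarrow> real\<close>; \<open>coeff_pred a n\<close> is \<open>a\<^sub>n\<^sub>-\<^sub>1\<close>, with the
  convention \<open>a\<^sub>-\<^sub>1 = 1/2\<close>.
\<close>

definition coeff_pred :: "(nat \<Rightarrow> real) \<Rightarrow> nat \<Rightarrow> real" where
  "coeff_pred a n = (case n of 0 \<Rightarrow> 1/2 | Suc m \<Rightarrow> a m)"

definition jalpha :: "(nat \<Rightarrow> real) \<Rightarrow> nat \<Rightarrow> real" where
  "jalpha a n = 1 / (2 * sqrt (coeff_pred a n * a n))"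

definition jbeta :: "(nat \<Rightarrow> real) \<Rightarrow> (nat \<Rightarrow> real) \<Rightarrow> nat \<Rightarrow> real" where
  "jbeta a b n = - b n / (2 * sqrt (coeff_pred a n * a n))"

definition jk :: "(nat \<Rightarrow> real) \<Rightarrow> nat \<Rightarrow> real" where
  "jk a n = a n / sqrt (coeff_pred a n * a (n + 1))"

definition phase :: "(nat \<Rightarrow> real) \<Rightarrow> (nat \<Rightarrow> real) \<Rightarrow> nat \<Rightarrow> real" where
  "phase a b n = (\<Sum>m | m < n \<and> \<bar>jbeta a b m\<bar> \<le> 1. arccos (jbeta a b m))"

text \<open>The summation index below is shifted: \<open>j\<close> corresponds to \<open>m = n + 1 + j\<close>.\<close>

definition remainder :: "(nat \<Rightarrow> real) \<Rightarrow> (nat \<Rightarrow> real) \<Rightarrow> nat \<Rightarrow> complex \<Rightarrow> real" where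
  "remainder a b n z =
     (\<Sum>j. \<bar>jbeta a b (n + j) - jbeta a b (n + 1 + j)\<bar> + \<bar>jk a (n + 1 + j) - 1\<bar>
           + jalpha a (n + 1 + j) * cmod z)"

text \<open>
  A solution is a sequence \<open>(F\<^sub>n)\<close> with \<open>n \<ge> -1\<close>, since the equation for \<open>n = 0\<close> involves
  \<open>F\<^sub>-\<^sub>1\<close>; hence \<open>F\<close> is indexed by integers. Its values at indices below \<open>-1\<close> are irrelevant.
\<close>

definition jacobi_solution ::
    "(nat \<Rightarrow> real) \<Rightarrow> (nat \<Rightarrow> real) \<Rightarrow> complex \<Rightarrow> (int \<Rightarrow> complex) \<Rightarrow> bool" where
  "jacobi_solution a b z F \<longleftrightarrow>
     (\<forall>n::nat. of_real (coeff_pred a n) * F (int n - 1) + of_real (b n) * F (int n)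
                 + of_real (a n) * F (int n + 1) = z * F (int n))"

definition minimal_exponential_type :: "(complex \<Rightarrow> complex) \<Rightarrow> bool" where
  "minimal_exponential_type h \<longleftrightarrow>
     h holomorphic_on UNIV \<and> (\<forall>\<epsilon>>0. \<exists>C. \<forall>z. cmod (h z) \<le> C * exp (\<epsilon> * cmod z))"

end

theory Submission
  imports Defs
begin

text \<open>
  With \<open>g\<^sub>n = sqrt a\<^sub>n f\<^sub>n\<close> and \<open>\<theta>\<^sub>n = arccos \<beta>\<^sub>n\<close> the Jacobi equation reads
  \<open>g\<^sub>n\<^sub>-\<^sub>1 = 2 (\<beta>\<^sub>n + \<alpha>\<^sub>n z) g\<^sub>n - k\<^sub>n g\<^sub>n\<^sub>+\<^sub>1\<close>. Once \<open>\<bar>\<beta>\<^sub>n\<bar>\<close> is bounded away from \<open>1\<close>, write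
  \<open>g\<^sub>n\<^sub>+\<^sub>1 - e\<^sup>-\<^sup>i\<^sup>\<theta> g\<^sub>n = e\<^sup>i\<^sup>\<phi> p\<^sub>n\<close> and \<open>g\<^sub>n\<^sub>+\<^sub>1 - e\<^sup>i\<^sup>\<theta> g\<^sub>n = e\<^sup>-\<^sup>i\<^sup>\<phi> q\<^sub>n\<close> with
  \<open>\<theta> = \<theta>\<^sub>n\<close>, \<open>\<phi> = \<phi>\<^sub>n\<close>. In the coordinates \<open>y\<^sub>n = (p\<^sub>n, q\<^sub>n)\<close> the step \<open>y\<^sub>n\<^sub>+\<^sub>1 \<mapsto> y\<^sub>n\<close> differs from
  the identity by an operator of norm at most a constant times the \<open>n\<close>-th term of the remainder
  \<open>\<epsilon>\<^sub>n\<close>, so the product of these steps converges and there is a solution with prescribed limit at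
  infinity. The limit \<open>(0, -2i sin \<theta>\<^sub>\<infinity>)\<close> gives the desired solution, and \<open>y\<^sub>n\<close> differs from it
  by \<open>O(\<epsilon>\<^sub>n)\<close>. The bound \<open>\<bar>y\<^sub>n\<bar> \<le> C exp (K \<epsilon>\<^sub>n)\<close> has an arbitrarily small rate in \<open>\<bar>z\<bar>\<close> for large \<open>n\<close>;
  the recurrence, whose coefficients are polynomials in \<open>z\<close>, carries this rate down to every \<open>n\<close>.
\<close>

section \<open>Infinite products of operators near the identity\<close>

text \<open>The finite product \<open>T m (T (m+1) (... (T (m+k-1) c)))\<close>. The recursion peels
  off the outermost factor, so inductions on \<open>k\<close> let \<open>m\<close> vary.\<close>

primrec backward_iterate :: "(nat \<Rightarrow> 'a \<Rightarrow> 'a) \<Rightarrow> 'a \<Rightarrow> nat \<Rightarrow> nat \<Rightarrow> 'a" where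
  "backward_iterate T c 0 m = c"
| "backward_iterate T c (Suc k) m = T m (backward_iterate T c k (Suc m))"

text \<open>The infinite product of the steps from \<open>m\<close> on, applied to \<open>c\<close>:
  the orbit with value \<open>c\<close> at infinity.\<close>

definition backward_limit :: "(nat \<Rightarrow> 'a::t2_space \<Rightarrow> 'a) \<Rightarrow> 'a \<Rightarrow> nat \<Rightarrow> 'a" where
  "backward_limit T c m = lim (\<lambda>k. backward_iterate T c k m)"

lemma backward_iterate_telescope:
  fixes c :: "'a::ab_group_add"
  shows "backward_iterate T c k m =
    c + (\<Sum>j<k. backward_iterate T c (Suc j) m - backward_iterate T c j m)"
  by (subst sum_lessThan_telescope) simp

locale near_identity =
  fixes T :: "nat \<Rightarrow> 'a::banach \<Rightarrow> 'a" and h :: "nat \<Rightarrow> real"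
  assumes linear_T: "\<And>n. linear (T n)"
    and T_near: "\<And>n x. norm (T n x - x) \<le> h n * norm x"
    and h_nonneg: "\<And>n. 0 \<le> h n"
    and summable_h: "summable h"
begin

definition tail :: "nat \<Rightarrow> real" where
  "tail m = (\<Sum>j. h (m + j))"

lemma summable_shift: "summable (\<lambda>j. h (m + j))"
  using summable_h summable_iff_shift[of h m] by (simp add: add.commute)

lemma sum_le_tail: "(\<Sum>j<k. h (m + j)) \<le> tail m"
  unfolding tail_def by (rule sum_le_suminf) (auto intro: summable_shift h_nonneg)

lemma norm_T_le: "norm (T n x) \<le> exp (h n) * norm x"
proof -
  have "norm (T n x) \<le> norm x + norm (T n x - x)"
    by (metis add.commute diff_add_cancel norm_triangle_ineq)
  also have "\<dots> \<le> (1 + h n) * norm x"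
    using T_near[of n x] by (simp add: algebra_simps)
  also have "\<dots> \<le> exp (h n) * norm x"
    by (intro mult_right_mono exp_ge_add_one_self) auto
  finally show ?thesis .
qed

lemma norm_backward_iterate_le:
  "norm (backward_iterate T c k m) \<le> norm c * exp (\<Sum>j<k. h (m + j))"
proof (induction k arbitrary: m)
  case (Suc k)
  have "norm (backward_iterate T c (Suc k) m) \<le> exp (h m) * norm (backward_iterate T c k (Suc m))"
    using norm_T_le by simp
  also have "\<dots> \<le> exp (h m) * (norm c * exp (\<Sum>j<k. h (Suc m + j)))"
    by (intro mult_left_mono Suc.IH) auto
  finally show ?case
    by (simp add: sum.lessThan_Suc_shift exp_add mult_ac del: sum.lessThan_Suc)
qed simp

text \<open>By linearity the difference is the product of \<open>T m, ..., T (m+k-1)\<close> applied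
  to \<open>T (m+k) c - c\<close>. This vector supplies the factor \<open>h (m+k)\<close>, the
  product supplies the exponential.\<close>

lemma backward_iterate_increment:
  "norm (backward_iterate T c (Suc k) m - backward_iterate T c k m)
    \<le> h (m + k) * (norm c * exp (\<Sum>j<k. h (m + j)))"
proof (induction k arbitrary: m)
  case 0
  then show ?case using T_near[of m c] by simp
next
  case (Suc k)
  let ?d = "backward_iterate T c (Suc k) (Suc m) - backward_iterate T c k (Suc m)"
  have "backward_iterate T c (Suc (Suc k)) m - backward_iterate T c (Suc k) m = T m ?d"
    using linear_T[of m] by (simp add: linear_diff)
  then have "norm (backward_iterate T c (Suc (Suc k)) m - backward_iterate T c (Suc k) m)
      \<le> exp (h m) * norm ?d"
    using norm_T_le by metis
  also have "\<dots> \<le> exp (h m) * (h (Suc m + k) * (norm c * exp (\<Sum>j<k. h (Suc m + j))))"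
    by (intro mult_left_mono Suc.IH) auto
  finally show ?case
    by (simp add: sum.lessThan_Suc_shift exp_add mult_ac del: sum.lessThan_Suc)
qed

lemma backward_iterate_increment':
  "norm (backward_iterate T c (Suc k) m - backward_iterate T c k m)
    \<le> norm c * exp (tail m) * h (m + k)"
proof -
  have "h (m + k) * (norm c * exp (\<Sum>j<k. h (m + j))) \<le> h (m + k) * (norm c * exp (tail m))"
    by (intro mult_left_mono) (auto simp: sum_le_tail h_nonneg)
  with backward_iterate_increment[of c k m] show ?thesis
    by (simp add: mult_ac)
qed

lemma backward_iterate_LIMSEQ:
  "(\<lambda>k. backward_iterate T c k m) \<longlonglongrightarrow> backward_limit T c m"
proof -
  have "summable (\<lambda>k. backward_iterate T c (Suc k) m - backward_iterate T c k m)"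
    by (rule summable_comparison_test'[OF _ backward_iterate_increment'])
      (intro summable_mult summable_shift)
  then have "convergent (\<lambda>k. c + (\<Sum>j<k. backward_iterate T c (Suc j) m - backward_iterate T c j m))"
    by (intro convergent_add convergent_const) (simp add: summable_iff_convergent)
  then show ?thesis
    unfolding backward_limit_def convergent_LIMSEQ_iff backward_iterate_telescope[symmetric] .
qed

lemma norm_backward_limit_le: "norm (backward_limit T c m) \<le> norm c * exp (tail m)"
proof (rule LIMSEQ_le_const2[OF tendsto_norm[OF backward_iterate_LIMSEQ]], intro exI allI impI)
  fix k
  show "norm (backward_iterate T c k m) \<le> norm c * exp (tail m)"
    by (rule order_trans[OF norm_backward_iterate_le]) (intro mult_left_mono, auto simp: sum_le_tail)
qed

text \<open>Summing the increments gives a multiple of \<open>tail m\<close>; this becomes the error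
  term of the asymptotics.\<close>

lemma norm_backward_limit_diff_le:
  "norm (backward_limit T c m - c) \<le> norm c * exp (tail m) * tail m"
proof (rule LIMSEQ_le_const2[OF tendsto_norm[OF tendsto_diff[OF backward_iterate_LIMSEQ tendsto_const]]],
    intro exI allI impI)
  fix k
  have "norm (backward_iterate T c k m - c) \<le>
      (\<Sum>j<k. norm (backward_iterate T c (Suc j) m - backward_iterate T c j m))"
    by (subst backward_iterate_telescope) (simp add: norm_sum del: backward_iterate.simps)
  also have "\<dots> \<le> (\<Sum>j<k. norm c * exp (tail m) * h (m + j))"
    by (intro sum_mono backward_iterate_increment')
  also have "\<dots> \<le> norm c * exp (tail m) * tail m"
    unfolding sum_distrib_left[symmetric] by (intro mult_left_mono sum_le_tail) auto
  finally show "norm (backward_iterate T c k m - c) \<le> norm c * exp (tail m) * tail m" .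
qed

lemma backward_limit_step:
  "backward_limit T c m = T m (backward_limit T c (Suc m))"
proof -
  have bl: "bounded_linear (T m)"
  proof (rule bounded_linear_intro)
    show "T m (x + y) = T m x + T m y" for x y using linear_T linear_add by blast
    show "T m (r *\<^sub>R x) = r *\<^sub>R T m x" for r x using linear_T linear_scale by blast
    show "norm (T m x) \<le> norm x * exp (h m)" for x
      using norm_T_le[of m x] by (simp add: mult.commute)
  qed
  have "(\<lambda>k. T m (backward_iterate T c k (Suc m))) \<longlonglongrightarrow> T m (backward_limit T c (Suc m))"
    by (rule bounded_linear.tendsto[OF bl backward_iterate_LIMSEQ])
  then have "(\<lambda>k. backward_iterate T c (Suc k) m) \<longlonglongrightarrow> T m (backward_limit T c (Suc m))"
    by simp
  moreover have "(\<lambda>k. backward_iterate T c (Suc k) m) \<longlonglongrightarrow> backward_limit T c m"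
    by (rule LIMSEQ_Suc[OF backward_iterate_LIMSEQ])
  ultimately show ?thesis using LIMSEQ_unique by blast
qed

end

text \<open>The increment bound depends on the common \<open>h\<close> and not on \<open>z\<close>,
  so the M-test applies. Holomorphy of the limit rests on this.\<close>

lemma uniform_limit_backward_iterate:
  fixes T :: "'b \<Rightarrow> nat \<Rightarrow> 'a::banach \<Rightarrow> 'a"
  assumes "\<And>z. z \<in> A \<Longrightarrow> near_identity (T z) h"
  shows "uniform_limit A (\<lambda>k z. backward_iterate (T z) c k m) (\<lambda>z. backward_limit (T z) c m) sequentially"
proof (cases "A = {}")
  case False
  \<comment> \<open>Any point of \<open>A\<close> will do: \<open>tail\<close> and the summability
    of \<open>h\<close> depend on \<open>h\<close> alone.\<close>
  then interpret near_identity "T (SOME z. z \<in> A)" h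
    using assms some_in_eq by blast
  let ?d = "\<lambda>k z. backward_iterate (T z) c (Suc k) m - backward_iterate (T z) c k m"
  have "uniform_limit A (\<lambda>k z. \<Sum>j<k. ?d j z) (\<lambda>z. \<Sum>j. ?d j z) sequentially"
  proof (rule Weierstrass_m_test)
    fix k z assume "z \<in> A"
    then show "norm (?d k z) \<le> norm c * exp (tail m) * h (m + k)"
      using near_identity.backward_iterate_increment'[OF assms] near_identity.tail_def[OF assms]
      by (metis tail_def)
  qed (intro summable_mult summable_shift)
  then have "uniform_limit A (\<lambda>k z. c + (\<Sum>j<k. ?d j z)) (\<lambda>z. c + (\<Sum>j. ?d j z)) sequentially"
    by (intro uniform_limit_intros)
  then have u: "uniform_limit A (\<lambda>k z. backward_iterate (T z) c k m) (\<lambda>z. c + (\<Sum>j. ?d j z)) sequentially"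
    unfolding backward_iterate_telescope[symmetric] .
  have "c + (\<Sum>j. ?d j z) = backward_limit (T z) c m" if "z \<in> A" for z
    using tendsto_uniform_limitI[OF u that]
      near_identity.backward_iterate_LIMSEQ[OF assms[OF that]] LIMSEQ_unique by blast
  then show ?thesis
    using u uniform_limit_cong'[of A "\<lambda>k z. backward_iterate (T z) c k m" "\<lambda>k z. backward_iterate (T z) c k m"
      "\<lambda>z. c + (\<Sum>j. ?d j z)" "\<lambda>z. backward_limit (T z) c m" sequentially] by simp
qed (auto simp: uniform_limit_iff)

section \<open>Algebra and trigonometry of a single step\<close>

text \<open>Here \<open>E\<close>, \<open>F\<close>, \<open>W\<close> stand for the exponentials of
  i times \<theta>_n, \<theta>_(n+1), \<phi>_n, and primes for inverses; \<open>(p, q)\<close> and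
  \<open>(p', q')\<close> are y_(n+1) and y_n, while \<open>G0\<close>, \<open>G1\<close> are
  g_(n+1), g_(n+2). The first conclusion says that g_(n+1) is read off y_n consistently, the second
  that g_n obeys the recurrence, since F + F' = 2 \<beta>_(n+1).\<close>

lemma wronskian_step_algebra:
  fixes E E' F F' W W' p q G0 G1 \<zeta> \<kappa> :: complex
  assumes E: "E * E' = 1" and F: "F * F' = 1" and W: "W * W' = 1" and FF: "F \<noteq> F'"
    and G0: "W * E * p - W' * E' * q = (F - F') * G0"
    and G1: "W * E * F * p - W' * E' * F' * q = (F - F') * G1"
  defines "p' \<equiv> p + W' * E' * ((E - F - \<zeta>) * G0 + \<kappa> * G1)"
    and "q' \<equiv> q + W * E * ((E' - F' - \<zeta>) * G0 + \<kappa> * G1)"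
  shows "W * E * p' - W' * E' * q' = (E - E') * G0"
    and "W * p' - W' * q' = (E - E') * ((F + F' + \<zeta>) * G0 - (1 + \<kappa>) * G1)"
proof -
  \<comment> \<open>Solving the two linear equations for \<open>p\<close> and \<open>q\<close>
    returns the first-order differences that define these coordinates.\<close>
  have P: "W * E * p = G1 - F' * G0"
  proof -
    have "(F - F') * (W * E * p) = (F - F') * (G1 - F' * G0)"
      using G0 G1 by algebra
    then show ?thesis using FF by simp
  qed
  have Q: "W' * E' * q = G1 - F * G0"
  proof -
    have "(F - F') * (W' * E' * q) = (F - F') * (G1 - F * G0)"
      using G0 G1 by algebra
    then show ?thesis using FF by simp
  qed
  have "W * E * p' = W * E * p + ((E - F - \<zeta>) * G0 + \<kappa> * G1)"
    using E W unfolding p'_def by algebra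
  moreover have "W' * E' * q' = W' * E' * q + ((E' - F' - \<zeta>) * G0 + \<kappa> * G1)"
    using E W unfolding q'_def by algebra
  ultimately have P': "W * E * p' = G1 - F' * G0 + ((E - F - \<zeta>) * G0 + \<kappa> * G1)"
    and Q': "W' * E' * q' = G1 - F * G0 + ((E' - F' - \<zeta>) * G0 + \<kappa> * G1)"
    using P Q by auto
  show "W * E * p' - W' * E' * q' = (E - E') * G0"
    unfolding P' Q' by algebra
  have "W * p' - W' * q' = E' * (W * E * p') - E * (W' * E' * q')"
    using E by algebra
  also have "\<dots> = (E - E') * ((F + F' + \<zeta>) * G0 - (1 + \<kappa>) * G1)"
    unfolding P' Q' by algebra
  finally show "W * p' - W' * q' = (E - E') * ((F + F' + \<zeta>) * G0 - (1 + \<kappa>) * G1)" .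
qed

text \<open>The difference of the sines is (cos y - cos x)(cos x + cos y) / (sin x + sin y), with
  denominator at least 2 s. Thus increments of \<open>\<beta>\<close> control those of the
  exponentials.\<close>

lemma sin_cis_diff_le_cos_diff:
  assumes "0 < s" "s \<le> sin x" "s \<le> sin y"
  shows "\<bar>sin x - sin y\<bar> \<le> \<bar>cos x - cos y\<bar> / s"
    and "cmod (cis x - cis y) \<le> (1 + 1 / s) * \<bar>cos x - cos y\<bar>"
proof -
  have "(sin x - sin y) * (sin x + sin y) = (cos y - cos x) * (cos x + cos y)"
    using sin_cos_squared_add[of x] sin_cos_squared_add[of y]
    by (simp add: algebra_simps power2_eq_square)
  then have "\<bar>sin x - sin y\<bar> * \<bar>sin x + sin y\<bar> = \<bar>cos x - cos y\<bar> * \<bar>cos x + cos y\<bar>"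
    by (metis abs_minus_commute abs_mult)
  moreover have "\<bar>cos x + cos y\<bar> \<le> 2"
    using abs_cos_le_one[of x] abs_cos_le_one[of y] by linarith
  ultimately have "\<bar>sin x - sin y\<bar> * \<bar>sin x + sin y\<bar> \<le> \<bar>cos x - cos y\<bar> * 2"
    by (simp add: mult_left_mono)
  moreover have "\<bar>sin x - sin y\<bar> * (2 * s) \<le> \<bar>sin x - sin y\<bar> * \<bar>sin x + sin y\<bar>"
    using assms by (intro mult_left_mono) auto
  ultimately show *: "\<bar>sin x - sin y\<bar> \<le> \<bar>cos x - cos y\<bar> / s"
    using assms by (simp add: field_simps)
  have "cmod (cis x - cis y) \<le> \<bar>cos x - cos y\<bar> + \<bar>sin x - sin y\<bar>"
    using cmod_le[of "cis x - cis y"] by simp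
  with * show "cmod (cis x - cis y) \<le> (1 + 1 / s) * \<bar>cos x - cos y\<bar>"
    by (simp add: algebra_simps)
qed

section \<open>The recurrence where \<open>\<beta>\<close> stays away from 1 and -1\<close>

text \<open>The sequences will be tails of those of the Jacobi equation, and \<open>\<sigma>\<close>
  will be the sine of the limiting angle. Only the increments of \<open>\<phi>\<close> are
  prescribed, so it may carry a contribution from earlier indices.\<close>

locale oscillatory_recurrence =
  fixes \<beta> \<theta> \<phi> \<alpha> k :: "nat \<Rightarrow> real" and s \<sigma> :: real
  assumes cos_\<theta>: "\<And>n. cos (\<theta> n) = \<beta> n"
    and sin_\<theta>: "\<And>n. s \<le> sin (\<theta> n)"
    and s_pos: "0 < s"
    and \<phi>_Suc: "\<And>n. \<phi> (Suc n) = \<phi> n + \<theta> n"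
    and \<alpha>_nonneg: "\<And>n. 0 \<le> \<alpha> n"
    and summable_\<alpha>: "summable \<alpha>"
    and summable_k: "summable (\<lambda>n. \<bar>k n - 1\<bar>)"
    and summable_\<beta>: "summable (\<lambda>n. \<bar>\<beta> n - \<beta> (Suc n)\<bar>)"
    and sin_lim: "(\<lambda>n. sin (\<theta> n)) \<longlonglongrightarrow> \<sigma>"
begin

text \<open>\<open>wave n m y\<close> recovers \<open>g\<^sub>m\<close> from the coordinates \<open>y = (p\<^sub>n, q\<^sub>n)\<close>, for \<open>m = n\<close> and
  \<open>m = n + 1\<close>.\<close>

definition wave :: "nat \<Rightarrow> nat \<Rightarrow> complex \<times> complex \<Rightarrow> complex" where
  "wave n m y = (cis (\<phi> m) * fst y - cis (- \<phi> m) * snd y) / (2 * \<i> * of_real (sin (\<theta> n)))"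

text \<open>The map from y_(n+1) to y_n; its components are \<open>p'\<close> and \<open>q'\<close>
  of \<open>wronskian_step_algebra\<close>.\<close>

definition step :: "complex \<Rightarrow> nat \<Rightarrow> complex \<times> complex \<Rightarrow> complex \<times> complex" where
  "step z n y =
    (let G0 = wave (Suc n) (Suc n) y; G1 = wave (Suc n) (Suc (Suc n)) y;
         \<zeta> = 2 * of_real (\<alpha> (Suc n)) * z; \<kappa> = of_real (k (Suc n)) - 1
     in (fst y + cis (- \<phi> (Suc n)) * ((cis (\<theta> n) - cis (\<theta> (Suc n)) - \<zeta>) * G0 + \<kappa> * G1),
         snd y + cis (\<phi> (Suc n)) * ((cis (- \<theta> n) - cis (- \<theta> (Suc n)) - \<zeta>) * G0 + \<kappa> * G1)))"

text \<open>The real \<open>x\<close> stands for a bound on \<open>cmod z\<close>, so that one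
  majorant serves a whole disc.\<close>

definition d :: "real \<Rightarrow> nat \<Rightarrow> real" where
  "d x n = \<bar>\<beta> n - \<beta> (Suc n)\<bar> + \<bar>k (Suc n) - 1\<bar> + \<alpha> (Suc n) * x"

definition rem :: "nat \<Rightarrow> real \<Rightarrow> real" where
  "rem n x = (\<Sum>j. d x (n + j))"

text \<open>The 2 counts the components of \<open>step\<close>, \<open>2 + 1 / s\<close> bounds the
  coefficients, and the last \<open>1 / s\<close> comes from \<open>norm_wave_le\<close>.\<close>

definition K :: real where
  "K = 2 * (2 + 1 / s) / s"

lemma sin_pos: "0 < sin (\<theta> n)"
  using sin_\<theta>[of n] s_pos by linarith

lemma two_i_sin: "cis x - cis (- x) = 2 * \<i> * of_real (sin x)"
  by (simp add: complex_eq_iff)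

lemma norm_wave_le: "cmod (wave n m y) \<le> norm y / s"
proof -
  have "cmod (cis (\<phi> m) * fst y - cis (- \<phi> m) * snd y) \<le> cmod (fst y) + cmod (snd y)"
    using norm_triangle_ineq4[of "cis (\<phi> m) * fst y" "cis (- \<phi> m) * snd y"] by (simp add: norm_mult)
  also have "\<dots> \<le> 2 * norm y"
    using norm_fst_le[of "fst y" "snd y"] norm_snd_le[of "snd y" "fst y"] by simp
  finally have "cmod (wave n m y) \<le> 2 * norm y / (2 * sin (\<theta> n))"
    using sin_pos[of n] divide_right_mono[of "cmod (cis (\<phi> m) * fst y - cis (- \<phi> m) * snd y)" "2 * norm y" "2 * sin (\<theta> n)"]
    by (simp add: wave_def norm_divide norm_mult)
  also have "\<dots> \<le> norm y / s"
    using s_pos sin_\<theta>[of n] by (simp add: frac_le)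
  finally show ?thesis .
qed

lemma linear_wave: "linear (wave n m)"
  unfolding wave_def
  by (intro linearI) (simp_all add: algebra_simps add_divide_distrib diff_divide_distrib scaleR_conv_of_real)

lemma linear_step: "linear (step z n)"
proof (rule linearI)
  show "step z n (x + y) = step z n x + step z n y" for x y
    by (simp add: step_def Let_def linear_add[OF linear_wave] prod_eq_iff algebra_simps)
  show "step z n (r *\<^sub>R x) = r *\<^sub>R step z n x" for r x
    by (simp add: step_def Let_def linear_scale[OF linear_wave] prod_eq_iff algebra_simps scaleR_conv_of_real)
qed

lemma d_nonneg: "0 \<le> x \<Longrightarrow> 0 \<le> d x n"
  unfolding d_def using \<alpha>_nonneg[of "Suc n"] by simp

lemma summable_d: "summable (d x)"
  unfolding d_def
  by (intro summable_add summable_\<beta> summable_mult2)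
    (use summable_k summable_\<alpha> summable_Suc_iff[of "\<lambda>n. \<bar>k n - 1\<bar>"] summable_Suc_iff[of \<alpha>] in auto)

lemma summable_d_shift: "summable (\<lambda>j. d x (n + j))"
  using summable_d summable_iff_shift[of "d x" n] by (simp add: add.commute)

lemma rem_nonneg: "0 \<le> x \<Longrightarrow> 0 \<le> rem n x"
  unfolding rem_def by (intro suminf_nonneg summable_d_shift d_nonneg)

lemma rem_mono: "x \<le> x' \<Longrightarrow> rem n x \<le> rem n x'"
  unfolding rem_def
  by (intro suminf_le summable_d_shift) (auto simp: d_def \<alpha>_nonneg mult_left_mono)

lemma rem_le_0: assumes "0 \<le> x" shows "rem n x \<le> rem 0 x"
proof -
  have "suminf (d x) = rem n x + (\<Sum>j<n. d x j)"
    unfolding rem_def using suminf_split_initial_segment[OF summable_d[of x], of n]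
    by (simp add: add.commute)
  moreover have "0 \<le> (\<Sum>j<n. d x j)" by (intro sum_nonneg d_nonneg assms)
  ultimately show ?thesis by (simp add: rem_def)
qed

lemma K_pos: "0 < K"
  using s_pos by (simp add: K_def add_pos_pos)

lemma norm_step_le:
  assumes "cmod z \<le> x"
  shows "norm (step z n y - y) \<le> K * d x n * norm y"
proof -
  define G0 G1 where "G0 = wave (Suc n) (Suc n) y" and "G1 = wave (Suc n) (Suc (Suc n)) y"
  define \<zeta> \<kappa> where "\<zeta> = 2 * of_real (\<alpha> (Suc n)) * z" and "\<kappa> = complex_of_real (k (Suc n)) - 1"
  have G: "cmod G0 \<le> norm y / s" "cmod G1 \<le> norm y / s"
    by (simp_all add: G0_def G1_def norm_wave_le)
  have \<zeta>: "cmod \<zeta> \<le> 2 * (\<alpha> (Suc n) * x)"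
    using assms \<alpha>_nonneg[of "Suc n"] by (simp add: \<zeta>_def norm_mult mult_left_mono)
  have \<kappa>: "cmod \<kappa> = \<bar>k (Suc n) - 1\<bar>"
    unfolding \<kappa>_def by (metis norm_of_real of_real_1 of_real_diff)
  \<comment> \<open>Up to a unimodular factor both components of the increment have this shape, with
    \<open>X\<close> a difference of exponentials.\<close>
  have *: "cmod ((X - \<zeta>) * G0 + \<kappa> * G1) \<le> (2 + 1 / s) * d x n * (norm y / s)"
    if X: "cmod X \<le> (1 + 1 / s) * \<bar>\<beta> n - \<beta> (Suc n)\<bar>" for X
  proof -
    have "cmod ((X - \<zeta>) * G0 + \<kappa> * G1) \<le> cmod (X - \<zeta>) * cmod G0 + cmod \<kappa> * cmod G1"
      by (metis norm_mult norm_triangle_ineq)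
    also have "\<dots> \<le> cmod (X - \<zeta>) * (norm y / s) + cmod \<kappa> * (norm y / s)"
      using G by (intro add_mono mult_left_mono) auto
    also have "\<dots> = (cmod (X - \<zeta>) + cmod \<kappa>) * (norm y / s)"
      by (simp add: algebra_simps)
    also have "\<dots> \<le> (2 + 1 / s) * d x n * (norm y / s)"
    proof (intro mult_right_mono)
      have "cmod (X - \<zeta>) + cmod \<kappa> \<le>
          (1 + 1 / s) * \<bar>\<beta> n - \<beta> (Suc n)\<bar> + 2 * (\<alpha> (Suc n) * x) + \<bar>k (Suc n) - 1\<bar>"
        using X \<zeta> \<kappa> norm_triangle_ineq4[of X \<zeta>] by linarith
      \<comment> \<open>\<open>2 + 1 / s\<close> dominates each of the coefficients
        \<open>1 + 1 / s\<close>, 2 and 1.\<close>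
      also have "\<dots> \<le> (2 + 1 / s) * \<bar>\<beta> n - \<beta> (Suc n)\<bar> + (2 + 1 / s) * (\<alpha> (Suc n) * x)
          + (2 + 1 / s) * \<bar>k (Suc n) - 1\<bar>"
      proof (intro add_mono mult_right_mono)
        show "\<bar>k (Suc n) - 1\<bar> \<le> (2 + 1 / s) * \<bar>k (Suc n) - 1\<bar>"
          using s_pos by (simp add: mult_le_cancel_right1)
        show "0 \<le> \<alpha> (Suc n) * x"
          using \<alpha>_nonneg[of "Suc n"] assms norm_ge_zero order_trans by (metis mult_nonneg_nonneg)
      qed (use s_pos in auto)
      also have "\<dots> = (2 + 1 / s) * d x n"
        by (simp add: d_def algebra_simps)
      finally show "cmod (X - \<zeta>) + cmod \<kappa> \<le> (2 + 1 / s) * d x n" .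
    qed (use s_pos in auto)
    finally show ?thesis .
  qed
  have X: "cmod (cis (\<theta> n) - cis (\<theta> (Suc n))) \<le> (1 + 1 / s) * \<bar>\<beta> n - \<beta> (Suc n)\<bar>"
    using sin_cis_diff_le_cos_diff(2)[OF s_pos sin_\<theta> sin_\<theta>, of n "Suc n"] by (simp add: cos_\<theta>)
  have X': "cmod (cis (- \<theta> n) - cis (- \<theta> (Suc n))) \<le> (1 + 1 / s) * \<bar>\<beta> n - \<beta> (Suc n)\<bar>"
  proof -
    have "cis (- \<theta> n) - cis (- \<theta> (Suc n)) = cnj (cis (\<theta> n) - cis (\<theta> (Suc n)))"
      by (simp add: cis_cnj)
    then show ?thesis using X by (metis complex_mod_cnj)
  qed
  have "step z n y - y =
     (cis (- \<phi> (Suc n)) * ((cis (\<theta> n) - cis (\<theta> (Suc n)) - \<zeta>) * G0 + \<kappa> * G1),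
      cis (\<phi> (Suc n)) * ((cis (- \<theta> n) - cis (- \<theta> (Suc n)) - \<zeta>) * G0 + \<kappa> * G1))"
    by (simp add: step_def Let_def G0_def G1_def \<zeta>_def \<kappa>_def prod_eq_iff)
  then have "norm (step z n y - y) \<le>
      cmod ((cis (\<theta> n) - cis (\<theta> (Suc n)) - \<zeta>) * G0 + \<kappa> * G1)
      + cmod ((cis (- \<theta> n) - cis (- \<theta> (Suc n)) - \<zeta>) * G0 + \<kappa> * G1)"
    using norm_Pair_le[of "cis (- \<phi> (Suc n)) * ((cis (\<theta> n) - cis (\<theta> (Suc n)) - \<zeta>) * G0 + \<kappa> * G1)"
      "cis (\<phi> (Suc n)) * ((cis (- \<theta> n) - cis (- \<theta> (Suc n)) - \<zeta>) * G0 + \<kappa> * G1)"]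
    by (simp add: norm_mult)
  also have "\<dots> \<le> 2 * ((2 + 1 / s) * d x n * (norm y / s))"
    using *[OF X] *[OF X'] by linarith
  finally show ?thesis by (simp add: K_def field_simps)
qed

lemma near_identity_step:
  assumes "cmod z \<le> x"
  shows "near_identity (step z) (\<lambda>n. K * d x n)"
proof (rule near_identity.intro)
  show "0 \<le> K * d x n" for n
    using K_pos d_nonneg[of x n] assms norm_ge_zero[of z] by simp
  show "norm (step z n y - y) \<le> K * d x n * norm y" for n y
    using assms by (rule norm_step_le)
  show "linear (step z n)" for n by (rule linear_step)
  show "summable (\<lambda>n. K * d x n)" by (intro summable_mult summable_d)
qed

lemma tail_eq: "0 \<le> x \<Longrightarrow> near_identity.tail (\<lambda>n. K * d x n) m = K * rem m x"
  unfolding rem_def using near_identity.tail_def[OF near_identity_step, of 0 x m]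
  by (simp add: suminf_mult summable_d_shift)

section \<open>The solution with prescribed behaviour at infinity\<close>

text \<open>The limit vector is normalised so that \<open>wave n n\<close> sends it to
  \<open>cis (- \<phi> n) * \<sigma> / sin (\<theta> n)\<close>, which is asymptotic to
  \<open>cis (- \<phi> n)\<close>.\<close>

definition state :: "complex \<Rightarrow> nat \<Rightarrow> complex \<times> complex" where
  "state z = backward_limit (step z) (0, - 2 * \<i> * of_real \<sigma>)"

definition jost :: "nat \<Rightarrow> complex \<Rightarrow> complex" where
  "jost n z = wave n n (state z n)"

lemma state_step: "state z n = step z n (state z (Suc n))"
  unfolding state_def by (rule near_identity.backward_limit_step[OF near_identity_step[of z "cmod z"]]) simp

lemma wave_mult: "(cis (\<theta> n) - cis (- \<theta> n)) * wave n m y = cis (\<phi> m) * fst y - cis (- \<phi> m) * snd y"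
  using sin_pos[of n] by (simp add: wave_def two_i_sin)

lemma cis_neq: "cis (\<theta> n) \<noteq> cis (- \<theta> n)"
  using sin_pos[of n] two_i_sin[of "\<theta> n"] by auto

lemma wave_step:
  shows "wave n (Suc n) (step z n y) = wave (Suc n) (Suc n) y"
    and "wave n n (step z n y) =
      2 * (of_real (\<beta> (Suc n)) + of_real (\<alpha> (Suc n)) * z) * wave (Suc n) (Suc n) y
      - of_real (k (Suc n)) * wave (Suc n) (Suc (Suc n)) y"
proof -
  have F: "cis (\<theta> n) * cis (- \<theta> n) = 1" for n by (simp add: cis_mult)
  have W: "cis (\<phi> n) * cis (- \<phi> n) = 1" for n by (simp add: cis_mult)
  have WE: "cis (\<phi> n) * cis (\<theta> n) = cis (\<phi> (Suc n))"
    "cis (- \<phi> n) * cis (- \<theta> n) = cis (- \<phi> (Suc n))" for n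
    by (simp_all add: cis_mult \<phi>_Suc)
  have two_\<beta>: "cis (\<theta> n) + cis (- \<theta> n) = 2 * of_real (\<beta> n)" for n
    by (simp add: complex_eq_iff flip: cos_\<theta>)
  \<comment> \<open>Once \<open>WE\<close> has contracted \<open>W * E\<close> and
    \<open>W * E * F\<close> to \<open>cis\<close> of later phases, \<open>wave_mult\<close>
    supplies the two equations for \<open>G0\<close> and \<open>G1\<close>.\<close>
  note A = wronskian_step_algebra[where \<zeta> = "2 * of_real (\<alpha> (Suc n)) * z" and \<kappa> = "of_real (k (Suc n)) - 1",
      OF F[of n] F[of "Suc n"] W[of n] cis_neq, unfolded WE,
      OF wave_mult[symmetric] wave_mult[symmetric]]
  have "(cis (\<theta> n) - cis (- \<theta> n)) * wave n (Suc n) (step z n y) =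
      (cis (\<theta> n) - cis (- \<theta> n)) * wave (Suc n) (Suc n) y"
    unfolding wave_mult using A(1)[of y] by (simp add: step_def Let_def)
  then show "wave n (Suc n) (step z n y) = wave (Suc n) (Suc n) y"
    using cis_neq[of n] by simp
  have "(cis (\<theta> n) - cis (- \<theta> n)) * wave n n (step z n y) =
      (cis (\<theta> n) - cis (- \<theta> n)) * (2 * (of_real (\<beta> (Suc n)) + of_real (\<alpha> (Suc n)) * z) * wave (Suc n) (Suc n) y
      - of_real (k (Suc n)) * wave (Suc n) (Suc (Suc n)) y)"
    unfolding wave_mult using A(2)[of y] unfolding two_\<beta> by (simp add: step_def Let_def algebra_simps)
  then show "wave n n (step z n y) =
      2 * (of_real (\<beta> (Suc n)) + of_real (\<alpha> (Suc n)) * z) * wave (Suc n) (Suc n) y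
      - of_real (k (Suc n)) * wave (Suc n) (Suc (Suc n)) y"
    using cis_neq[of n] by simp
qed

lemma jost_recurrence:
  "jost n z = 2 * (of_real (\<beta> (Suc n)) + of_real (\<alpha> (Suc n)) * z) * jost (Suc n) z
    - of_real (k (Suc n)) * jost (Suc (Suc n)) z"
proof -
  \<comment> \<open>The value of g_(n+2) read off y_(n+1) agrees with the one read off
    y_(n+2).\<close>
  have "wave (Suc n) (Suc (Suc n)) (state z (Suc n)) = jost (Suc (Suc n)) z"
    using wave_step(1)[of "Suc n" z "state z (Suc (Suc n))"]
    unfolding jost_def state_step[symmetric] .
  then show ?thesis
    using wave_step(2)[of n z "state z (Suc n)"] unfolding state_step[symmetric]
    by (simp only: jost_def)
qed

text \<open>Finite iterates are polynomials in \<open>z\<close>. On the unit ball around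
  \<open>z\<close> the majorant with \<open>x = cmod z + 1\<close> makes them converge
  uniformly.\<close>

lemma jost_holomorphic: "jost n holomorphic_on UNIV"
proof -
  let ?c = "(0, - 2 * \<i> * of_real \<sigma>) :: complex \<times> complex"
  let ?b = "\<lambda>k z. backward_iterate (step z) ?c k n"
  have hol: "(\<lambda>z. fst (backward_iterate (step z) ?c k m)) holomorphic_on UNIV \<and>
      (\<lambda>z. snd (backward_iterate (step z) ?c k m)) holomorphic_on UNIV" for k m
  proof (induction k arbitrary: m)
    case (Suc k)
    then show ?case
      by (auto simp: step_def Let_def wave_def sin_pos less_imp_neq[OF sin_pos, symmetric] intro!: holomorphic_intros)
  qed auto
  have "(\<lambda>z. wave n n (state z n)) holomorphic_on UNIV"
  proof (rule holomorphic_uniform_sequence[where f = "\<lambda>k z. wave n n (?b k z)"])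
    show "(\<lambda>z. wave n n (?b k z)) holomorphic_on UNIV" for k
      unfolding wave_def using hol[of k n] less_imp_neq[OF sin_pos, of n]
      by (auto intro!: holomorphic_intros)
    fix z :: complex
    have "uniform_limit (cball z 1) ?b (\<lambda>z. state z n) sequentially"
      unfolding state_def
    proof (rule uniform_limit_backward_iterate)
      fix w assume "w \<in> cball z 1"
      then have "cmod w \<le> cmod z + 1"
        using norm_triangle_ineq4[of z "z - w"] by (simp add: dist_norm)
      then show "near_identity (step w) (\<lambda>n. K * d (cmod z + 1) n)"
        by (rule near_identity_step)
    qed
    moreover have "bounded_linear (wave n n)"
      using linear_wave by (simp add: linear_conv_bounded_linear)
    ultimately have "uniform_limit (cball z 1) (\<lambda>k w. wave n n (?b k w)) (\<lambda>w. wave n n (state w n)) sequentially"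
      by (rule bounded_linear.uniform_limit[rotated])
    then show "\<exists>d>0. cball z d \<subseteq> UNIV \<and>
        uniform_limit (cball z d) (\<lambda>k w. wave n n (?b k w)) (\<lambda>w. wave n n (state w n)) sequentially"
      by (intro exI[of _ 1]) auto
  qed auto
  then show ?thesis unfolding jost_def .
qed

section \<open>Asymptotics and growth in \<open>z\<close>\<close>

text \<open>Telescoping and passing to the limit; needed because the leading coefficient is \<sigma>
  / sin \<theta>_n and not exactly 1.\<close>

lemma sin_diff_limit_le:
  assumes "0 \<le> x"
  shows "\<bar>\<sigma> - sin (\<theta> n)\<bar> \<le> rem n x / s"
proof (rule LIMSEQ_le_const2[OF tendsto_rabs[OF tendsto_diff[OF LIMSEQ_ignore_initial_segment[OF sin_lim, of n] tendsto_const]]],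
    intro exI allI impI)
  fix m
  have "\<bar>sin (\<theta> (m + n)) - sin (\<theta> n)\<bar> = \<bar>\<Sum>j<m. sin (\<theta> (Suc j + n)) - sin (\<theta> (j + n))\<bar>"
    by (subst sum_lessThan_telescope) simp
  also have "\<dots> \<le> (\<Sum>j<m. \<bar>sin (\<theta> (Suc j + n)) - sin (\<theta> (j + n))\<bar>)"
    by (rule sum_abs)
  also have "\<dots> \<le> (\<Sum>j<m. d x (n + j) / s)"
  proof (rule sum_mono)
    fix j
    have "\<bar>sin (\<theta> (Suc j + n)) - sin (\<theta> (j + n))\<bar> \<le> \<bar>\<beta> (Suc j + n) - \<beta> (j + n)\<bar> / s"
      using sin_cis_diff_le_cos_diff(1)[OF s_pos sin_\<theta> sin_\<theta>, of "Suc j + n" "j + n"] by (simp only: cos_\<theta>)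
    also have "\<dots> \<le> d x (n + j) / s"
      using s_pos \<alpha>_nonneg[of "Suc (n + j)"] assms
      by (intro divide_right_mono) (auto simp: d_def add.commute abs_minus_commute)
    finally show "\<bar>sin (\<theta> (Suc j + n)) - sin (\<theta> (j + n))\<bar> \<le> d x (n + j) / s" .
  qed
  also have "\<dots> \<le> rem n x / s"
    unfolding rem_def sum_divide_distrib[symmetric] using s_pos
    by (intro divide_right_mono sum_le_suminf summable_d_shift) (auto simp: d_nonneg assms)
  finally show "\<bar>sin (\<theta> (m + n)) - sin (\<theta> n)\<bar> \<le> rem n x / s" .
qed

text \<open>Two errors add up: the distance of \<open>state z n\<close> from its limit, and the
  deviation of \<sigma> / sin \<theta>_n from 1.\<close>

lemma jost_asymptotics:
  "\<exists>C. \<forall>n z. cmod z \<le> R \<longrightarrow> cmod (cis (\<phi> n) * jost n z - 1) \<le> C * rem n (cmod z)"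
proof (intro exI allI impI)
  fix n z assume z: "cmod z \<le> R"
  let ?c = "(0, - 2 * \<i> * of_real \<sigma>) :: complex \<times> complex"
  define \<rho> where "\<rho> = rem n (cmod z)"
  \<comment> \<open>Replacing the exponent by its bound at \<open>rem 0 R\<close> makes the constant
    independent of \<open>n\<close> and \<open>z\<close>.\<close>
  define M where "M = norm ?c * exp (K * rem 0 R) * K"
  have \<rho>: "0 \<le> \<rho>" "\<rho> \<le> rem 0 R"
    using rem_le_0[of "cmod z" n] rem_mono[OF z, of 0] by (auto simp: \<rho>_def rem_nonneg)
  define y where "y = state z n - ?c"
  have "norm y \<le> norm ?c * exp (K * \<rho>) * (K * \<rho>)"
    using near_identity.norm_backward_limit_diff_le[OF near_identity_step[of z "cmod z"], of ?c n]
    by (simp add: y_def state_def tail_eq \<rho>_def)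
  also have "\<dots> \<le> norm ?c * exp (K * rem 0 R) * (K * \<rho>)"
    using \<rho> K_pos by (intro mult_right_mono mult_left_mono) auto
  finally have y: "norm y \<le> M * \<rho>" by (simp add: M_def mult_ac)
  have "wave n n ?c * cis (\<phi> n) = of_real \<sigma> / of_real (sin (\<theta> n))"
    using sin_pos[of n] by (simp add: wave_def field_simps cis_mult)
  then have "cis (\<phi> n) * jost n z - 1 =
      cis (\<phi> n) * wave n n y + of_real \<sigma> / of_real (sin (\<theta> n)) - 1"
    unfolding jost_def y_def linear_diff[OF linear_wave] by (simp add: algebra_simps)
  also have "\<dots> = cis (\<phi> n) * wave n n y + of_real ((\<sigma> - sin (\<theta> n)) / sin (\<theta> n))"
    using sin_pos[of n] by (simp add: field_simps)
  finally have "cmod (cis (\<phi> n) * jost n z - 1) \<le>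
      cmod (wave n n y) + \<bar>(\<sigma> - sin (\<theta> n)) / sin (\<theta> n)\<bar>"
    by (metis norm_triangle_ineq norm_mult norm_cis mult_1 norm_of_real)
  also have "\<bar>(\<sigma> - sin (\<theta> n)) / sin (\<theta> n)\<bar> \<le> rem n (cmod z) / s / s"
    unfolding abs_divide using sin_\<theta>[of n] s_pos sin_diff_limit_le[of "cmod z" n]
    by (intro frac_le) auto
  also have "cmod (wave n n y) \<le> M * \<rho> / s"
    using norm_wave_le[of n n y] y s_pos by (meson divide_right_mono less_imp_le order_trans)
  finally show "cmod (cis (\<phi> n) * jost n z - 1) \<le> (M / s + 1 / s / s) * rem n (cmod z)"
    by (simp add: \<rho>_def algebra_simps)
qed

text \<open>Isolates the dependence on \<open>x\<close>: the slope is a tail of the series of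
  \<open>\<alpha>\<close>, hence small for large \<open>n\<close>.\<close>

lemma rem_split: "rem n x = rem n 0 + (\<Sum>j. \<alpha> (j + Suc n)) * x"
proof -
  have "summable (\<lambda>j. \<alpha> (j + Suc n))" using summable_\<alpha> by (subst summable_iff_shift)
  then have "rem n 0 + (\<Sum>j. \<alpha> (j + Suc n)) * x = (\<Sum>j. d 0 (n + j) + \<alpha> (j + Suc n) * x)"
    unfolding rem_def by (subst suminf_add[symmetric]) (auto simp: suminf_mult2 summable_d_shift summable_mult2)
  then show ?thesis by (simp add: rem_def d_def add.commute)
qed

lemma jost_growth:
  assumes "0 < \<epsilon>"
  shows "\<forall>\<^sub>F n in sequentially. \<exists>C. \<forall>z. cmod (jost n z) \<le> C * exp (\<epsilon> * cmod z)"
proof -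
  \<comment> \<open>Beyond \<open>N\<close> the rate \<open>K\<close> times this slope, which
    governs the growth of \<open>state z n\<close>, is at most \<open>\<epsilon>\<close>.\<close>
  obtain N where N: "\<And>n. n \<ge> N \<Longrightarrow> \<bar>\<Sum>j. \<alpha> (j + n)\<bar> < \<epsilon> / K"
    using suminf_exist_split[OF _ summable_\<alpha>, of "\<epsilon> / K"] assms K_pos by auto
  show ?thesis
  proof (rule eventually_sequentiallyI[of N], intro exI allI)
    fix n z assume n: "N \<le> n"
    let ?c = "(0, - 2 * \<i> * of_real \<sigma>) :: complex \<times> complex"
    have "\<bar>\<Sum>j. \<alpha> (j + Suc n)\<bar> < \<epsilon> / K"
      using n by (intro N) simp
    then have "K * (\<Sum>j. \<alpha> (j + Suc n)) \<le> \<epsilon>"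
      using K_pos by (simp add: field_simps abs_less_iff)
    then have "K * (\<Sum>j. \<alpha> (j + Suc n)) * cmod z \<le> \<epsilon> * cmod z"
      by (rule mult_right_mono) simp
    then have 1: "K * rem n (cmod z) \<le> K * rem n 0 + \<epsilon> * cmod z"
      by (subst rem_split) (simp add: algebra_simps)
    have "norm (state z n) \<le> norm ?c * exp (K * rem n (cmod z))"
      using near_identity.norm_backward_limit_le[OF near_identity_step[of z "cmod z"], of ?c n]
      by (simp add: state_def tail_eq)
    also have "\<dots> \<le> norm ?c * (exp (K * rem n 0) * exp (\<epsilon> * cmod z))"
      using 1 by (intro mult_left_mono) (simp_all add: exp_add[symmetric])
    finally have "norm (state z n) / s \<le> norm ?c * (exp (K * rem n 0) * exp (\<epsilon> * cmod z)) / s"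
      using s_pos by (intro divide_right_mono) auto
    with norm_wave_le[of n n "state z n"]
    show "cmod (jost n z) \<le> (norm ?c * exp (K * rem n 0) / s) * exp (\<epsilon> * cmod z)"
      unfolding jost_def by simp
  qed
qed

end

section \<open>Passing from large indices to all indices\<close>

text \<open>Downwards the recurrence is explicit: overwriting the value at \<open>N\<close> by the
  recurrence, as \<open>G'\<close> does, lowers the threshold by one.\<close>

lemma recurrence_extend_down:
  fixes G :: "nat \<Rightarrow> 'a"
  assumes "\<And>n. n \<ge> N \<Longrightarrow> G n = \<Phi> n (G (Suc n)) (G (Suc (Suc n)))"
  shows "\<exists>g. (\<forall>n\<ge>N. g n = G n) \<and> (\<forall>n. g n = \<Phi> n (g (Suc n)) (g (Suc (Suc n))))"
  using assms
proof (induction N arbitrary: G)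
  case 0
  show ?case by (intro exI[of _ G] conjI allI impI refl 0 le0)
next
  case (Suc N)
  define G' where "G' = G(N := \<Phi> N (G (Suc N)) (G (Suc (Suc N))))"
  have G'_rec: "G' n = \<Phi> n (G' (Suc n)) (G' (Suc (Suc n)))" if "n \<ge> N" for n
    using Suc.prems[of n] that by (cases "n = N") (auto simp: G'_def)
  have "\<exists>g. (\<forall>n\<ge>N. g n = G' n) \<and> (\<forall>n. g n = \<Phi> n (g (Suc n)) (g (Suc (Suc n))))"
    by (rule Suc.IH) (rule G'_rec)
  then obtain g where g: "\<forall>n\<ge>N. g n = G' n"
    and rec: "\<forall>n. g n = \<Phi> n (g (Suc n)) (g (Suc (Suc n)))" by (elim exE conjE)
  from g have "\<forall>n\<ge>Suc N. g n = G n" by (simp add: G'_def)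
  with rec show ?case by (intro exI[of _ g] conjI)
qed

lemma backward_induct_two:
  fixes P :: "nat \<Rightarrow> bool"
  assumes "\<forall>\<^sub>F n in sequentially. P n"
    and "\<And>n. P (Suc n) \<Longrightarrow> P (Suc (Suc n)) \<Longrightarrow> P n"
  shows "P n"
proof -
  obtain N where N: "\<And>n. n \<ge> N \<Longrightarrow> P n"
    using assms(1) by (auto simp: eventually_sequentially)
  have "n \<le> max n N" by simp
  \<comment> \<open>The recurrence has order two, so the descent carries \<open>P\<close> at two
    neighbouring indices.\<close>
  then have "P n \<and> P (Suc n)"
    by (induction rule: inc_induct) (use N assms(2) in auto)
  then show ?thesis by simp
qed

text \<open>Below, bounds for all rates \<open>\<delta> > \<epsilon>\<close> are used instead of the single rate \<open>\<epsilon>\<close>: this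
  property survives multiplication by polynomials.\<close>

definition exp_bounded :: "real \<Rightarrow> (complex \<Rightarrow> complex) \<Rightarrow> bool" where
  "exp_bounded \<delta> h \<longleftrightarrow> (\<exists>C. \<forall>z. cmod (h z) \<le> C * exp (\<delta> * cmod z))"

lemma exp_bounded_mono:
  assumes "exp_bounded \<delta> h" "\<delta> \<le> \<delta>'"
  shows "exp_bounded \<delta>' h"
proof -
  obtain C where C: "\<And>z. cmod (h z) \<le> C * exp (\<delta> * cmod z)"
    using assms by (auto simp: exp_bounded_def)
  have "0 \<le> C" using order_trans[OF norm_ge_zero C[of 0]] by simp
  then have "C * exp (\<delta> * cmod z) \<le> C * exp (\<delta>' * cmod z)" for z
    using assms(2) by (intro mult_left_mono) (auto intro: mult_right_mono)
  then show ?thesis unfolding exp_bounded_def using C order_trans by blast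
qed

lemma exp_bounded_add:
  assumes "exp_bounded \<delta> f" "exp_bounded \<delta> g"
  shows "exp_bounded \<delta> (\<lambda>z. f z + g z)"
proof -
  obtain C D where C: "\<And>z. cmod (f z) \<le> C * exp (\<delta> * cmod z)"
      and D: "\<And>z. cmod (g z) \<le> D * exp (\<delta> * cmod z)"
    using assms by (auto simp: exp_bounded_def)
  have "cmod (f z + g z) \<le> (C + D) * exp (\<delta> * cmod z)" for z
    using norm_triangle_ineq[of "f z" "g z"] C[of z] D[of z] by (simp add: distrib_right)
  then show ?thesis unfolding exp_bounded_def by blast
qed

lemma exp_bounded_mult:
  assumes "exp_bounded \<delta> f" "exp_bounded \<eta> g"
  shows "exp_bounded (\<delta> + \<eta>) (\<lambda>z. f z * g z)"
proof -
  obtain C D where C: "\<And>z. cmod (f z) \<le> C * exp (\<delta> * cmod z)"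
      and D: "\<And>z. cmod (g z) \<le> D * exp (\<eta> * cmod z)"
    using assms by (auto simp: exp_bounded_def)
  have "cmod (f z * g z) \<le> (C * D) * exp ((\<delta> + \<eta>) * cmod z)" for z
  proof -
    have "cmod (f z * g z) \<le> (C * exp (\<delta> * cmod z)) * (D * exp (\<eta> * cmod z))"
      unfolding norm_mult using C[of z] D[of z]
      by (intro mult_mono) (auto intro: order_trans[OF norm_ge_zero])
    then show ?thesis by (simp add: exp_add distrib_right algebra_simps)
  qed
  then show ?thesis unfolding exp_bounded_def by blast
qed

lemma exp_bounded_const: "0 \<le> \<delta> \<Longrightarrow> exp_bounded \<delta> (\<lambda>z. c)"
  unfolding exp_bounded_def by (intro exI[of _ "cmod c"]) (simp add: mult_le_cancel_left1)

lemma exp_bounded_id: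
  assumes "0 < \<delta>"
  shows "exp_bounded \<delta> (\<lambda>z. z)"
proof -
  have "cmod z \<le> 1 / \<delta> * exp (\<delta> * cmod z)" for z
  proof -
    have "\<delta> * cmod z \<le> exp (\<delta> * cmod z)"
      using exp_ge_add_one_self[of "\<delta> * cmod z"] by linarith
    then show ?thesis using assms by (simp add: field_simps)
  qed
  then show ?thesis unfolding exp_bounded_def by blast
qed

lemma exp_bounded_affine_recurrence:
  assumes f: "\<And>\<delta>. \<delta> > \<epsilon> \<Longrightarrow> exp_bounded \<delta> f"
    and g: "\<And>\<delta>. \<delta> > \<epsilon> \<Longrightarrow> exp_bounded \<delta> g" and "\<delta> > \<epsilon>"
  shows "exp_bounded \<delta> (\<lambda>z. (A + B * z) * f z + D * g z)"
proof -
  \<comment> \<open>Half of the gap pays for the affine factor; the rest keeps the rate used for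
    \<open>f\<close> above \<open>\<epsilon>\<close>.\<close>
  define \<eta> where "\<eta> = (\<delta> - \<epsilon>) / 2"
  have \<eta>: "0 < \<eta>" "\<delta> - \<eta> > \<epsilon>" using \<open>\<delta> > \<epsilon>\<close> by (auto simp: \<eta>_def field_simps)
  have "exp_bounded \<eta> (\<lambda>z. B * z)"
    using exp_bounded_mult[OF exp_bounded_const[of 0 B] exp_bounded_id[OF \<eta>(1)]] by simp
  then have "exp_bounded \<eta> (\<lambda>z. A + B * z)"
    using \<eta>(1) by (intro exp_bounded_add exp_bounded_const) simp_all
  then have "exp_bounded \<delta> (\<lambda>z. (A + B * z) * f z)"
    using exp_bounded_mult[OF _ f[OF \<eta>(2)], of \<eta>] by simp
  moreover have "exp_bounded \<delta> (\<lambda>z. D * g z)"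
    using exp_bounded_mult[OF exp_bounded_const[of 0 D] g[OF \<open>\<delta> > \<epsilon>\<close>]] by simp
  ultimately show ?thesis by (rule exp_bounded_add)
qed

lemma minimal_exponential_type_iff:
  "minimal_exponential_type h \<longleftrightarrow> h holomorphic_on UNIV \<and> (\<forall>\<epsilon>>0. exp_bounded \<epsilon> h)"
  by (simp add: minimal_exponential_type_def exp_bounded_def)

section \<open>Jacobi coefficients and rescaling\<close>

lemma phase_Suc:
  assumes "\<bar>jbeta a b n\<bar> \<le> 1"
  shows "phase a b (Suc n) = phase a b n + arccos (jbeta a b n)"
proof -
  have "{m. m < Suc n \<and> \<bar>jbeta a b m\<bar> \<le> 1} = insert n {m. m < n \<and> \<bar>jbeta a b m\<bar> \<le> 1}"
    using assms by (auto simp: less_Suc_eq)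
  then show ?thesis by (simp add: phase_def)
qed

lemma jalpha_nonneg: "(\<And>n. a n > 0) \<Longrightarrow> 0 \<le> jalpha a n"
  by (simp add: jalpha_def coeff_pred_def less_imp_le split: nat.split)

text \<open>The inequality of arithmetic and geometric means bounds the terms by those of the series
  of \<open>1 / a n\<close>. Starting at \<open>Suc n\<close> keeps the conventional a_(-1) out of
  the estimate.\<close>

lemma summable_jalpha:
  assumes pos: "\<And>n. a n > 0" and "summable (\<lambda>n. 1 / a n)"
  shows "summable (jalpha a)"
proof -
  have "summable (\<lambda>n. jalpha a (Suc n))"
  proof (rule summable_comparison_test')
    show "summable (\<lambda>n. (1 / a n + 1 / a (Suc n)) / 4)"
      using assms(2) summable_Suc_iff[of "\<lambda>n. 1 / a n"]
      by (intro summable_divide summable_add) auto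
    show "norm (jalpha a (Suc n)) \<le> (1 / a n + 1 / a (Suc n)) / 4" for n
    proof -
      have "sqrt (1 / a n * (1 / a (Suc n))) \<le> (1 / a n + 1 / a (Suc n)) / 2"
        using pos[of n] pos[of "Suc n"] by (intro arith_geo_mean_sqrt) auto
      moreover have "jalpha a (Suc n) = sqrt (1 / a n * (1 / a (Suc n))) / 2"
        by (simp add: jalpha_def coeff_pred_def real_sqrt_divide real_sqrt_mult)
      ultimately show ?thesis using jalpha_nonneg[of a "Suc n", OF pos] by simp
    qed
  qed
  then show ?thesis by (simp only: summable_Suc_iff)
qed

text \<open>The substitution \<open>g\<^sub>n = sqrt a\<^sub>n f\<^sub>n\<close> turns the Jacobi equation into a recurrence whose
  coefficients are \<open>\<beta>\<^sub>n\<close>, \<open>\<alpha>\<^sub>n\<close> and \<open>k\<^sub>n\<close> only; \<open>f\<^sub>-\<^sub>1\<close> is read off the equation for \<open>n = 0\<close>.\<close>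

definition jacobi_rescale :: "(nat \<Rightarrow> real) \<Rightarrow> (nat \<Rightarrow> real) \<Rightarrow> (nat \<Rightarrow> complex \<Rightarrow> complex) \<Rightarrow> int \<Rightarrow> complex \<Rightarrow> complex" where
  "jacobi_rescale a b g m z =
    (let F = (\<lambda>n. g n z / of_real (sqrt (a n)))
     in if m \<ge> 0 then F (nat m) else 2 * (z * F 0 - of_real (b 0) * F 0 - of_real (a 0) * F 1))"

lemma jacobi_solution_rescale:
  assumes pos: "\<And>n. a n > 0"
    and rec: "\<And>n. g n z = 2 * (of_real (jbeta a b (Suc n)) + of_real (jalpha a (Suc n)) * z) * g (Suc n) z
        - of_real (jk a (Suc n)) * g (Suc (Suc n)) z"
  shows "jacobi_solution a b z (\<lambda>m. jacobi_rescale a b g m z)"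
  unfolding jacobi_solution_def
proof
  fix n
  define F where "F = (\<lambda>n. g n z / of_real (sqrt (a n)))"
  have F: "jacobi_rescale a b g (int n) z = F n" for n
    by (simp add: jacobi_rescale_def F_def)
  have F_Suc: "jacobi_rescale a b g (int n + 1) z = F (Suc n)" for n
    using F[of "Suc n"] by (simp add: add.commute)
  show "of_real (coeff_pred a n) * jacobi_rescale a b g (int n - 1) z
      + of_real (b n) * jacobi_rescale a b g (int n) z
      + of_real (a n) * jacobi_rescale a b g (int n + 1) z = z * jacobi_rescale a b g (int n) z"
  proof (cases n)
    case 0
    \<comment> \<open>The factor 2 is 1 / a_(-1).\<close>
    have "jacobi_rescale a b g (- 1) z = 2 * (z * F 0 - of_real (b 0) * F 0 - of_real (a 0) * F 1)"
      by (simp add: jacobi_rescale_def F_def)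
    then show ?thesis
      using F[of 0] F_Suc[of 0] by (simp add: 0 coeff_pred_def diff_divide_distrib)
  next
    case (Suc m)
    \<comment> \<open>In terms of these square roots all coefficients are rational.\<close>
    define x y w where "x = sqrt (a m)" and "y = sqrt (a (Suc m))" and "w = sqrt (a (Suc (Suc m)))"
    have nz: "x > 0" "y > 0" "w > 0" using pos by (auto simp: x_def y_def w_def)
    have sq: "a m = x * x" "a (Suc m) = y * y"
      using pos[of m] pos[of "Suc m"] by (simp_all add: x_def y_def)
    have c: "jbeta a b (Suc m) = - b (Suc m) / (2 * (x * y))" "jalpha a (Suc m) = 1 / (2 * (x * y))"
      "jk a (Suc m) = y * y / (x * w)"
      by (simp_all add: jbeta_def jalpha_def jk_def coeff_pred_def real_sqrt_mult sq(2)[symmetric]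
          flip: x_def y_def w_def)
    have "of_real (x * x) * (g m z / of_real x) + of_real (b (Suc m)) * (g (Suc m) z / of_real y)
        + of_real (y * y) * (g (Suc (Suc m)) z / of_real w) = z * (g (Suc m) z / of_real y)"
      unfolding rec[of m] c using nz by (simp add: field_simps)
    then have "of_real (a m) * F m + of_real (b (Suc m)) * F (Suc m) + of_real (a (Suc m)) * F (Suc (Suc m))
        = z * F (Suc m)"
      unfolding F_def x_def[symmetric] y_def[symmetric] w_def[symmetric] unfolding sq .
    then show ?thesis
      using F[of m] F[of "Suc m"] F_Suc[of "Suc m"] by (simp add: Suc coeff_pred_def add.commute)
  qed
qed

section \<open>Transfer to the Jacobi equation\<close>

theorem theorem3p8:
  fixes a b :: "nat \<Rightarrow> real" and \<beta>_inf :: real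
  assumes "\<And>n. a n > 0"
    and "summable (\<lambda>n. 1 / a n)"
    and "jbeta a b \<longlonglongrightarrow> \<beta>_inf"
    and "\<bar>\<beta>_inf\<bar> < 1"
    and "summable (\<lambda>n. \<bar>jk a n - 1\<bar>)"
    and "summable (\<lambda>n. \<bar>jbeta a b (n + 1) - jbeta a b n\<bar>)"
  shows "\<exists>f :: int \<Rightarrow> complex \<Rightarrow> complex.
           (\<forall>z. jacobi_solution a b z (\<lambda>n. f n z)) \<and>
           (\<exists>r :: nat \<Rightarrow> complex \<Rightarrow> complex.
              (\<forall>n z. f (int n) z =
                 of_real (1 / sqrt (a n)) * exp (- \<i> * of_real (phase a b n)) * (1 + r n z)) \<and>
              (\<forall>K. compact K \<longrightarrow>
                 (\<lambda>(n, z). r n z) \<in> O[sequentially \<times>\<^sub>F principal K](\<lambda>(n, z). of_real (remainder a b n z)))) \<and>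
           (\<forall>n::nat. minimal_exponential_type (f (int n)))"
proof -
  \<comment> \<open>The midpoint between \<bar>\<beta>_inf\<bar> and 1: eventually
    \<bar>\<beta>_n\<bar> < \<rho>, and then the sines are at least
    \<open>sqrt (1 - \<rho>\<^sup>2)\<close>.\<close>
  define \<rho> where "\<rho> = (1 + \<bar>\<beta>_inf\<bar>) / 2"
  have \<rho>: "\<bar>\<beta>_inf\<bar> < \<rho>" "0 \<le> \<rho>" "\<rho> < 1" using assms(4) by (auto simp: \<rho>_def)
  have "\<forall>\<^sub>F n in sequentially. \<bar>jbeta a b n\<bar> < \<rho>"
    using order_tendstoD(2)[OF tendsto_rabs[OF assms(3)] \<rho>(1)] .
  then obtain N where N: "\<And>n. n \<ge> N \<Longrightarrow> \<bar>jbeta a b n\<bar> < \<rho>"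
    by (auto simp: eventually_sequentially)
  have \<beta>1: "\<bar>jbeta a b (N + n)\<bar> \<le> 1" for n
    using N[of "N + n"] \<rho> by simp
  \<comment> \<open>All sequences are shifted by \<open>N\<close>; the phase keeps its terms below
    \<open>N\<close>, so the normalisation is already the required one.\<close>
  interpret oscillatory_recurrence "\<lambda>n. jbeta a b (N + n)" "\<lambda>n. arccos (jbeta a b (N + n))"
    "\<lambda>n. phase a b (N + n)" "\<lambda>n. jalpha a (N + n)" "\<lambda>n. jk a (N + n)"
    "sqrt (1 - \<rho>\<^sup>2)" "sqrt (1 - \<beta>_inf\<^sup>2)"
  proof
    have sin_eq: "sin (arccos (jbeta a b (N + n))) = sqrt (1 - (jbeta a b (N + n))\<^sup>2)" for n
      using \<beta>1[of n] by (intro sin_arccos_abs)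
    fix n
    show "cos (arccos (jbeta a b (N + n))) = jbeta a b (N + n)"
      using \<beta>1[of n] by (intro cos_arccos_abs)
    have "(jbeta a b (N + n))\<^sup>2 \<le> \<rho>\<^sup>2"
      using N[of "N + n"] \<rho>(2) abs_le_square_iff[of "jbeta a b (N + n)" \<rho>] by simp
    then show "sqrt (1 - \<rho>\<^sup>2) \<le> sin (arccos (jbeta a b (N + n)))"
      unfolding sin_eq by simp
    show "0 < sqrt (1 - \<rho>\<^sup>2)"
      using \<rho> by (simp add: power_less_one_iff abs_square_less_1)
    show "phase a b (N + Suc n) = phase a b (N + n) + arccos (jbeta a b (N + n))"
      using phase_Suc[OF \<beta>1[of n]] by simp
    show "0 \<le> jalpha a (N + n)" using assms(1) by (rule jalpha_nonneg)
    show "summable (\<lambda>n. jalpha a (N + n))"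
      using summable_jalpha[OF assms(1,2)] summable_iff_shift[of "jalpha a" N] by (simp add: add.commute)
    show "summable (\<lambda>n. \<bar>jk a (N + n) - 1\<bar>)"
      using assms(5) summable_iff_shift[of "\<lambda>n. \<bar>jk a n - 1\<bar>" N] by (simp add: add.commute)
    show "summable (\<lambda>n. \<bar>jbeta a b (N + n) - jbeta a b (N + Suc n)\<bar>)"
      using assms(6) summable_iff_shift[of "\<lambda>n. \<bar>jbeta a b (n + 1) - jbeta a b n\<bar>" N]
      by (simp add: add.commute abs_minus_commute)
    show "(\<lambda>n. sin (arccos (jbeta a b (N + n)))) \<longlonglongrightarrow> sqrt (1 - \<beta>_inf\<^sup>2)"
      unfolding sin_eq using LIMSEQ_ignore_initial_segment[OF assms(3), of N]
      by (intro tendsto_intros) (simp add: add.commute)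
  qed
  have rem_eq: "rem n (cmod z) = remainder a b (N + n) z" for n z
    by (simp add: rem_def d_def remainder_def add.assoc)
  \<comment> \<open>The recurrence acts on functions of \<open>z\<close>, so that a single downward
    extension serves all \<open>z\<close>.\<close>
  define \<Phi> where "\<Phi> n u v = (\<lambda>z. 2 * (of_real (jbeta a b (Suc n)) + of_real (jalpha a (Suc n)) * z) * u z
        - of_real (jk a (Suc n)) * v z)" for n and u v :: "complex \<Rightarrow> complex"
  have G: "jost (n - N) = \<Phi> n (jost (Suc n - N)) (jost (Suc (Suc n) - N))" if "n \<ge> N" for n
  proof
    fix z
    show "jost (n - N) z = \<Phi> n (jost (Suc n - N)) (jost (Suc (Suc n) - N)) z"
      using jost_recurrence[of "n - N" z] that by (simp add: \<Phi>_def Suc_diff_le)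
  qed
  obtain g where g_eq: "\<And>n. n \<ge> N \<Longrightarrow> g n = jost (n - N)"
      and g_rec: "\<And>n. g n = \<Phi> n (g (Suc n)) (g (Suc (Suc n)))"
    using recurrence_extend_down[of N "\<lambda>n. jost (n - N)" \<Phi>, OF G] by blast
  have g_hol: "g n holomorphic_on UNIV" for n
  proof (rule backward_induct_two)
    show "\<forall>\<^sub>F n in sequentially. g n holomorphic_on UNIV"
      using g_eq jost_holomorphic by (intro eventually_sequentiallyI[of N]) simp
    show "g n holomorphic_on UNIV"
      if "g (Suc n) holomorphic_on UNIV" "g (Suc (Suc n)) holomorphic_on UNIV" for n
      by (subst g_rec) (use that in \<open>auto simp: \<Phi>_def intro!: holomorphic_intros\<close>)
  qed
  have g_bounded: "\<forall>\<delta>>\<epsilon>. exp_bounded \<delta> (g n)" if "\<epsilon> > 0" for \<epsilon> n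
  proof (rule backward_induct_two)
    have "\<forall>\<^sub>F n in sequentially. exp_bounded \<epsilon> (jost (n - N))"
      using jost_growth[OF that] eventually_sequentially_seg[of "\<lambda>n. exp_bounded \<epsilon> (jost (n - N))" N]
      by (simp add: exp_bounded_def)
    then show "\<forall>\<^sub>F n in sequentially. \<forall>\<delta>>\<epsilon>. exp_bounded \<delta> (g n)"
      using eventually_ge_at_top[of N]
      by eventually_elim (use g_eq exp_bounded_mono in auto)
    show "\<forall>\<delta>>\<epsilon>. exp_bounded \<delta> (g n)"
      if "\<forall>\<delta>>\<epsilon>. exp_bounded \<delta> (g (Suc n))" "\<forall>\<delta>>\<epsilon>. exp_bounded \<delta> (g (Suc (Suc n)))" for n
    proof (intro allI impI)
      fix \<delta> assume "\<delta> > \<epsilon>"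
      then have "exp_bounded \<delta> (\<lambda>z. (2 * of_real (jbeta a b (Suc n)) + 2 * of_real (jalpha a (Suc n)) * z) * g (Suc n) z
          + (- of_real (jk a (Suc n))) * g (Suc (Suc n)) z)"
        using that by (intro exp_bounded_affine_recurrence[of \<epsilon>]) auto
      then show "exp_bounded \<delta> (g n)"
        by (subst g_rec) (simp add: \<Phi>_def algebra_simps)
    qed
  qed
  define f where "f = jacobi_rescale a b g"
  \<comment> \<open>\<open>r\<close> is the asymptotic formula solved for its error, so
    \<open>f_r\<close> is an identity and the content lies in \<open>r_O\<close>.\<close>
  define r where "r n z = cis (phase a b n) * g n z - 1" for n z
  have f_eq: "f (int n) = (\<lambda>z. of_real (1 / sqrt (a n)) * g n z)" for n
    by (rule ext) (simp add: f_def jacobi_rescale_def)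
  have sol: "jacobi_solution a b z (\<lambda>n. f n z)" for z
    unfolding f_def by (rule jacobi_solution_rescale[OF assms(1)]) (subst g_rec, simp add: \<Phi>_def)
  have f_r: "f (int n) z = of_real (1 / sqrt (a n)) * exp (- \<i> * of_real (phase a b n)) * (1 + r n z)" for n z
  proof -
    have "exp (- \<i> * of_real (phase a b n)) * (1 + r n z) = g n z"
      by (simp add: r_def cis_conv_exp flip: exp_add mult.assoc)
    then show ?thesis by (simp add: f_eq mult.assoc)
  qed
  have r_O: "(\<lambda>(n, z). r n z) \<in> O[sequentially \<times>\<^sub>F principal K](\<lambda>(n, z). of_real (remainder a b n z))"
    if K: "compact K" for K
  proof -
    obtain R where R: "\<And>z. z \<in> K \<Longrightarrow> cmod z \<le> R"
      using compact_imp_bounded[OF K] by (auto simp: bounded_iff)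
    obtain C where C: "\<And>n z. cmod z \<le> R \<Longrightarrow> cmod (cis (phase a b (N + n)) * jost n z - 1) \<le> C * rem n (cmod z)"
      using jost_asymptotics[of R] by blast
    have "cmod (r n z) \<le> C * \<bar>remainder a b n z\<bar>" if "n \<ge> N" "z \<in> K" for n z
      using C[OF R[OF that(2)], of "n - N"] that(1) rem_nonneg[of "cmod z" "n - N"]
      by (simp add: r_def g_eq rem_eq)
    \<comment> \<open>In this product filter the threshold concerns \<open>n\<close> alone, which
      expresses uniformity over \<open>K\<close>.\<close>
    moreover have "\<forall>\<^sub>F x in sequentially \<times>\<^sub>F principal K. fst x \<ge> N \<and> snd x \<in> K"
      unfolding eventually_prod_filter
      by (intro exI[of _ "\<lambda>n. n \<ge> N"] exI[of _ "\<lambda>z. z \<in> K"]) (simp add: eventually_principal)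
    ultimately show ?thesis
      by (intro bigoI[where c = C]) (auto elim!: eventually_mono)
  qed
  have met: "minimal_exponential_type (f (int n))" for n
    unfolding minimal_exponential_type_iff
  proof (intro conjI allI impI)
    show "f (int n) holomorphic_on UNIV"
      unfolding f_eq by (intro holomorphic_intros g_hol)
    fix \<epsilon> :: real assume "\<epsilon> > 0"
    \<comment> \<open>\<open>g_bounded\<close> yields rates strictly above its parameter, hence the
      choice \<open>\<epsilon> / 2\<close>.\<close>
    then have "exp_bounded \<epsilon> (g n)" using g_bounded[of "\<epsilon> / 2" n] by simp
    then show "exp_bounded \<epsilon> (f (int n))"
      unfolding f_eq using exp_bounded_mult[OF exp_bounded_const[of 0 "of_real (1 / sqrt (a n))"]] by fastforce
  qed
  show ?thesis
    by (intro exI[of _ f] exI[of _ r] conjI allI impI sol f_r r_O met)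
qed


end
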